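(* For any tree $T$ with radius $r$ and any $n$-vertex graph $H$ with $E(H)\neq\emptyset$, $$\mathrm{gm}(T\cdot H)\leq 5 n^{1-1/2^r} \mathrm{tw}(H)^{1/2^r}.$$
   Context: For a graph $G$, $\mathrm{gm}(G)$ is the maximum integer $k$ such that the $k\times k$ grid is a minor of $G$, and $\mathrm{tw}(G)$ is the treewidth of $G$. $G_1\cdot G_2$ denotes the lexicographic product: vertex set $V(G_1)\times V(G_2)$, where distinct $(u_1,u_2),(v_1,v_2)$ are adjacent iff $u_1v_1\in E(G_1)$, or $u_1=v_1$ and $u_2v_2\in E(G_2)$. *)

theory Defs
  imports Complex_Main "Graph_Theory.Graph_Theory"
begin

text \<open>
  A finite simple undirected graph is a \<^typ>\<open>'a pair_pre_digraph\<close> satisfying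
  \<^locale>\<open>pair_graph\<close>; every edge is represented by its two arcs.
\<close>

text \<open>
  The library's \<^const>\<open>Digraph_Component.tree\<close> cannot be used here: in a symmetric digraph each
  edge traversed back and forth is already a \<^const>\<open>pre_digraph.cycle\<close>. The
  cycles of length at least 3 are exactly the cycles of the undirected simple graph. Note that
  \<^const>\<open>Digraph_Component.connected\<close> requires at least one vertex.
\<close>
definition is_tree :: "'a pair_pre_digraph \<Rightarrow> bool" where
  "is_tree T \<longleftrightarrow> pair_graph T \<and> Digraph_Component.connected (with_proj T) \<and>
     \<not> (\<exists>p. pre_digraph.cycle (with_proj T) p \<and> 3 \<le> length p)"

definition graph_dist :: "'a pair_pre_digraph \<Rightarrow> 'a \<Rightarrow> 'a \<Rightarrow> ereal" where
  "graph_dist G = wf_digraph.\<mu> (with_proj G) (\<lambda>_. 1)"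

definition radius :: "'a pair_pre_digraph \<Rightarrow> ereal" where
  "radius G = (INF u\<in>pverts G. SUP v\<in>pverts G. graph_dist G u v)"

text \<open>The factors are loopless, so adjacent vertices of the product are automatically distinct.\<close>
definition lex_product ::
    "'a pair_pre_digraph \<Rightarrow> 'b pair_pre_digraph \<Rightarrow> ('a \<times> 'b) pair_pre_digraph" where
  "lex_product G1 G2 = \<lparr> pverts = pverts G1 \<times> pverts G2,
     parcs = {((u1, u2), (v1, v2)) | u1 u2 v1 v2.
        (u1, u2) \<in> pverts G1 \<times> pverts G2 \<and> (v1, v2) \<in> pverts G1 \<times> pverts G2 \<and>
        ((u1, v1) \<in> parcs G1 \<or> u1 = v1 \<and> (u2, v2) \<in> parcs G2)} \<rparr>"

definition grid :: "nat \<Rightarrow> (nat \<times> nat) pair_pre_digraph" where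
  "grid k = \<lparr> pverts = {1..k} \<times> {1..k},
     parcs = {((i, j), (i', j')) | i j i' j'.
        i \<in> {1..k} \<and> j \<in> {1..k} \<and> i' \<in> {1..k} \<and> j' \<in> {1..k} \<and>
        (i = i' \<and> (j' = Suc j \<or> j = Suc j') \<or> j = j' \<and> (i' = Suc i \<or> i = Suc i'))} \<rparr>"

text \<open>
  \<open>M\<close> assigns to every vertex of \<open>H\<close> its branch set. Branch sets are nonempty, since
  \<^const>\<open>Digraph_Component.connected\<close> excludes the null graph.
\<close>
definition is_minor :: "'h pair_pre_digraph \<Rightarrow> 'g pair_pre_digraph \<Rightarrow> bool" where
  "is_minor H G \<longleftrightarrow> (\<exists>M :: 'h \<Rightarrow> 'g set.
     (\<forall>x\<in>pverts H. M x \<subseteq> pverts G \<and> Digraph_Component.connected (with_proj G \<restriction> M x)) \<and>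
     (\<forall>x\<in>pverts H. \<forall>y\<in>pverts H. x \<noteq> y \<longrightarrow> M x \<inter> M y = {}) \<and>
     (\<forall>(x, y)\<in>parcs H. \<exists>u\<in>M x. \<exists>v\<in>M y. (u, v) \<in> parcs G))"

definition gm :: "'a pair_pre_digraph \<Rightarrow> nat" where
  "gm G = Max {k. is_minor (grid k) G}"

definition tree_decomposition ::
    "'a pair_pre_digraph \<Rightarrow> 't pair_pre_digraph \<Rightarrow> ('t \<Rightarrow> 'a set) \<Rightarrow> bool" where
  "tree_decomposition G S B \<longleftrightarrow> is_tree S \<and>
     (\<forall>x\<in>pverts S. B x \<subseteq> pverts G) \<and>
     (\<forall>(u, v)\<in>parcs G. \<exists>x\<in>pverts S. u \<in> B x \<and> v \<in> B x) \<and>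
     (\<forall>v\<in>pverts G. Digraph_Component.connected (with_proj S \<restriction> {x \<in> pverts S. v \<in> B x}))"

text \<open>The subtraction is on \<^typ>\<open>nat\<close>, so the null graph gets treewidth 0 instead of -1.\<close>
definition decomposition_width :: "'t pair_pre_digraph \<Rightarrow> ('t \<Rightarrow> 'a set) \<Rightarrow> nat" where
  "decomposition_width S B = Max ((\<lambda>x. card (B x)) ` pverts S) - 1"

text \<open>
  A definition cannot quantify over the type of the tree nodes; \<^typ>\<open>nat\<close> loses nothing, because
  every finite tree is isomorphic to one whose nodes are natural numbers.
\<close>
definition treewidth :: "'a pair_pre_digraph \<Rightarrow> nat" where
  "treewidth G = (LEAST w. \<exists>(S :: nat pair_pre_digraph) B.
     tree_decomposition G S B \<and> decomposition_width S B = w)"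

lemma pair_graph_lex_product:
  assumes "pair_graph G1" "pair_graph G2"
  shows "pair_graph (lex_product G1 G2)"
proof -
  interpret A: pair_graph G1 by fact
  interpret B: pair_graph G2 by fact
  have "parcs (lex_product G1 G2) \<subseteq>
      (pverts G1 \<times> pverts G2) \<times> (pverts G1 \<times> pverts G2)"
    by (auto simp: lex_product_def)
  moreover have "finite ((pverts G1 \<times> pverts G2) \<times> (pverts G1 \<times> pverts G2))"
    by simp
  ultimately have "finite (parcs (lex_product G1 G2))"
    by (rule finite_subset)
  then show ?thesis
    by unfold_locales
      (auto simp: lex_product_def symmetric_def sym_def
        dest: A.no_loops' B.no_loops' A.arcs_symmetric B.arcs_symmetric)
qed

lemma pair_graph_grid: "pair_graph (grid k)"
proof -
  have "parcs (grid k) \<subseteq> ({1..k} \<times> {1..k}) \<times> ({1..k} \<times> {1..k})"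
    by (auto simp: grid_def)
  then have "finite (parcs (grid k))"
    by (rule finite_subset) simp
  then show ?thesis
    by unfold_locales (auto simp: grid_def symmetric_def sym_def)
qed

lemma connected_not_empty:
  "Digraph_Component.connected G \<Longrightarrow> verts G \<noteq> {}"
  by (auto simp: Digraph_Component.connected_def strongly_connected_def mk_symmetric_def)

lemma gm_well_defined:
  assumes "pair_graph G"
  shows "finite {k. is_minor (grid k) G}" "is_minor (grid 0) G"
proof -
  interpret pair_graph G by fact
  have "k \<le> card (pverts G)" if minor: "is_minor (grid k) G" for k
  proof -
    from minor obtain M where
      "\<forall>x\<in>pverts (grid k). M x \<subseteq> pverts G \<and> Digraph_Component.connected (with_proj G \<restriction> M x)"
      "\<forall>x\<in>pverts (grid k). \<forall>y\<in>pverts (grid k). x \<noteq> y \<longrightarrow> M x \<inter> M y = {}"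
      unfolding is_minor_def by (elim exE conjE)
    then have M:
      "\<And>x. x \<in> pverts (grid k) \<Longrightarrow>
         M x \<subseteq> pverts G \<and> Digraph_Component.connected (with_proj G \<restriction> M x)"
      "\<And>x y. x \<in> pverts (grid k) \<Longrightarrow> y \<in> pverts (grid k) \<Longrightarrow> x \<noteq> y \<Longrightarrow> M x \<inter> M y = {}"
      by simp_all
    have ne: "M x \<noteq> {}" if "x \<in> pverts (grid k)" for x
      using connected_not_empty[of "with_proj G \<restriction> M x"] M(1)[OF that] by simp
    define f where "f x = (SOME u. u \<in> M x)" for x
    have f: "f x \<in> M x" if "x \<in> pverts (grid k)" for x
      unfolding f_def using ne[OF that] by (simp add: some_in_eq)
    have "inj_on f (pverts (grid k))"
    proof (rule inj_onI, rule ccontr)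
      fix x y assume "x \<in> pverts (grid k)" "y \<in> pverts (grid k)" "f x = f y" "x \<noteq> y"
      then show False using f[of x] f[of y] M(2)[of x y] by auto
    qed
    moreover have "f ` pverts (grid k) \<subseteq> pverts G"
      by (intro image_subsetI) (use f M(1) in \<open>metis subsetD\<close>)
    ultimately have "card (pverts (grid k)) \<le> card (pverts G)"
      using pair_finite_verts by (rule card_inj_on_le)
    then have "k * k \<le> card (pverts G)"
      by (simp add: grid_def)
    then show ?thesis
      by (metis le_square order_trans)
  qed
  then show "finite {k. is_minor (grid k) G}"
    by (auto intro: finite_subset[of _ "{..card (pverts G)}"])
  show "is_minor (grid 0) G"
    by (auto simp: is_minor_def grid_def)
qed

lemma tree_decomposition_exists:
  assumes "pair_graph G"
  shows "\<exists>(S :: nat pair_pre_digraph) B. tree_decomposition G S B"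
proof -
  interpret pair_graph G by fact
  define S :: "nat pair_pre_digraph" where "S = \<lparr> pverts = {0}, parcs = {} \<rparr>"
  interpret S: pair_graph S
    by unfold_locales (auto simp: S_def symmetric_def sym_def)
  have conn: "Digraph_Component.connected D" if "verts D = {0 :: nat}" for D :: "(nat, nat \<times> nat) pre_digraph"
    using that by (auto simp: Digraph_Component.connected_def strongly_connected_def
      mk_symmetric_def reachable_def)
  have "\<not> S.cycle p" for p
    by (cases p) (auto simp: S.cycle_def S.awalk_def, auto simp: S_def)
  moreover have "Digraph_Component.connected (with_proj S)"
    by (rule conn) (simp add: S_def)
  ultimately have "is_tree S"
    unfolding is_tree_def using S.pair_graph by blast
  then have "tree_decomposition G S (\<lambda>_. pverts G)"
    unfolding tree_decomposition_def
    by (auto simp: S_def intro!: conn dest: in_arcsD1 in_arcsD2)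
  then show ?thesis by blast
qed

end

theory Submission
  imports Defs
begin

text \<open>
  Induction on the depth of \<open>T\<close>, rooted at a centre. For \<open>r = 0\<close> the product is \<open>H\<close>, and the crosses
  (a row together with a column) of a \<open>k \<times> k\<close> grid minor intersect pairwise, so by the Helly
  property of subtrees some bag meets all of them, whence \<open>k \<le> tw(H) + 1\<close>; the same argument
  with \<open>T\<close> in place of a decomposition tree gives \<open>k \<le> n\<close> for every \<open>T\<close>. In the induction step the
  copy of \<open>H\<close> at the root of the connected projection of the model meets at most \<open>n\<close> branch sets.
  An \<open>m \<times> m\<close> block of the grid in which fewer than \<open>m - a\<close> vertices are hit contains an
  \<open>(a + 1) \<times> (a + 1)\<close> grid minor avoiding the root, which is impossible if \<open>a\<close> bounds the grid
  order one level below. Hence each of the \<open>q\<^sup>2\<close> blocks of side \<open>k div q\<close> has at least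
  \<open>k div q - a\<close> hit vertices, and \<open>q \<approx> k / (2a + 2)\<close> gives \<open>k\<^sup>2 \<le> 5 n a\<close>. This
  matches the recursion \<open>f (r + 1)\<^sup>2 = n f r\<close> satisfied by \<open>f r = n powr (1 - 1/2^r) * tw(H) powr (1/2^r)\<close>.
\<close>

section \<open>Connected vertex sets and the Helly property of trees\<close>

text \<open>Strong connectivity of the subgraph induced on \<open>C\<close>, which for symmetric
  \<open>E\<close> is ordinary connectedness. Phrased through closed subsets, it lets connectivity
  be proved by closure arguments without walks.\<close>

definition conn :: "('a \<times> 'a) set \<Rightarrow> 'a set \<Rightarrow> bool" where
  "conn E C \<longleftrightarrow> C \<noteq> {} \<and> (\<forall>A \<subseteq> C. A \<noteq> {} \<longrightarrow> E `` A \<inter> C \<subseteq> A \<longrightarrow> A = C)"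

lemma connD: "conn E C \<Longrightarrow> A \<subseteq> C \<Longrightarrow> A \<noteq> {} \<Longrightarrow> E `` A \<inter> C \<subseteq> A \<Longrightarrow> A = C"
  unfolding conn_def by blast

lemma conn_nonempty: "conn E C \<Longrightarrow> C \<noteq> {}"
  unfolding conn_def by blast

lemma conn_singleton: "conn E {x}"
  unfolding conn_def by auto

text \<open>A piece \<open>M x\<close> that meets a closed set \<open>A\<close> lies inside
  \<open>A\<close>, and the links then make the set of such indices closed under \<open>R\<close>.
  This is the common source of connectivity for branch sets of composed minors, traces on
  decomposition trees and projections.\<close>

lemma conn_UN:
  assumes X: "conn R X" and M: "\<And>x. x \<in> X \<Longrightarrow> conn E (M x)"
    and link: "\<And>x y. x \<in> X \<Longrightarrow> y \<in> X \<Longrightarrow> (x, y) \<in> R \<Longrightarrow> \<exists>u\<in>M x. \<exists>v\<in>M y. u = v \<or> (u, v) \<in> E"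
  shows "conn E (\<Union>x\<in>X. M x)"
  unfolding conn_def
proof (intro conjI allI impI)
  show "(\<Union>x\<in>X. M x) \<noteq> {}"
    using X M by (fastforce simp: conn_def)
next
  fix A assume sub: "A \<subseteq> (\<Union>x\<in>X. M x)" and ne: "A \<noteq> {}" and cl: "E `` A \<inter> (\<Union>x\<in>X. M x) \<subseteq> A"
  define Y where "Y = {x\<in>X. M x \<inter> A \<noteq> {}}"
  have full: "M x \<subseteq> A" if "x \<in> Y" for x
  proof -
    have "M x \<inter> A = M x"
      by (rule connD[OF M]) (use that cl in \<open>auto simp: Y_def\<close>)
    then show ?thesis by blast
  qed
  have "Y = X"
  proof (rule connD[OF X])
    show "Y \<noteq> {}" using ne sub unfolding Y_def by blast
    show "R `` Y \<inter> X \<subseteq> Y"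
    proof clarify
      fix x y assume xy: "x \<in> Y" "(x, y) \<in> R" "y \<in> X"
      then obtain u v where uv: "u \<in> M x" "v \<in> M y" "u = v \<or> (u, v) \<in> E"
        using link[of x y] unfolding Y_def by blast
      have "v \<in> A" using uv full[OF xy(1)] cl xy(3) by blast
      then show "y \<in> Y" using uv xy unfolding Y_def by blast
    qed
  qed (auto simp: Y_def)
  then show "A = (\<Union>x\<in>X. M x)" using full sub by blast
qed

lemma conn_image:
  assumes "conn R X" "\<And>x y. x \<in> X \<Longrightarrow> y \<in> X \<Longrightarrow> (x, y) \<in> R \<Longrightarrow> f x = f y \<or> (f x, f y) \<in> E"
  shows "conn E (f ` X)"
proof -
  have "conn E (\<Union>x\<in>X. {f x})"
    by (rule conn_UN[OF assms(1)]) (use assms(2) conn_singleton in auto)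
  then show ?thesis by (simp add: UNION_singleton_eq_range)
qed

lemma conn_Un:
  assumes C: "conn E C" and D: "conn E D" and x: "x \<in> C \<inter> D"
  shows "conn E (C \<union> D)"
proof -
  \<comment> \<open>With all index pairs related, the common point \<open>x\<close> serves as every
    link (the case \<open>u = v\<close>).\<close>
  have "conn UNIV {C, D}"
    unfolding conn_def by blast
  then have "conn E (\<Union>X\<in>{C, D}. X)"
    by (rule conn_UN) (use assms in auto)
  then show ?thesis by simp
qed

lemma connI_rtrancl:
  assumes "C \<noteq> {}" "\<And>x y. x \<in> C \<Longrightarrow> y \<in> C \<Longrightarrow> (x, y) \<in> (E \<inter> C \<times> C)\<^sup>*"
  shows "conn E C"
  unfolding conn_def
proof (intro conjI allI impI)
  fix A assume A: "A \<subseteq> C" "A \<noteq> {}" "E `` A \<inter> C \<subseteq> A"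
  then obtain a where "a \<in> A" by blast
  have "y \<in> A" if "(a, y) \<in> (E \<inter> C \<times> C)\<^sup>*" for y
    using that by induct (use \<open>a \<in> A\<close> A in auto)
  then show "A = C" using assms(2) A \<open>a \<in> A\<close> by blast
qed (fact assms(1))

lemma connected_imp_conn:
  assumes G: "pair_graph G" and con: "Digraph_Component.connected (with_proj G \<restriction> C)"
  shows "conn (parcs G) C"
proof (rule connI_rtrancl)
  interpret pair_graph G by fact
  let ?S = "mk_symmetric (with_proj G \<restriction> C)"
  \<comment> \<open>The arcs of \<open>G\<close> are already symmetric, so symmetrising creates no
    new arc.\<close>
  have S: "pverts ?S = C" "parcs ?S \<subseteq> parcs G \<inter> C \<times> C"
    by (auto simp: mk_symmetric_def intro: arcs_symmetric)
  show "C \<noteq> {}"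
    using con S unfolding connected_def strongly_connected_def by simp
  fix x y assume "x \<in> C" "y \<in> C"
  then have "(x, y) \<in> rtrancl_on C (parcs ?S)"
    using con S unfolding connected_def strongly_connected_def reachable_def by simp
  then show "(x, y) \<in> (parcs G \<inter> C \<times> C)\<^sup>*"
    by induct (use S in \<open>auto intro: converse_rtrancl_into_rtrancl\<close>)
qed

lemma conn_imp_rtrancl:
  assumes "conn E C" "x \<in> C" "y \<in> C"
  shows "(x, y) \<in> E\<^sup>*"
proof -
  have "{y\<in>C. (x, y) \<in> E\<^sup>*} = C"
    by (rule connD[OF assms(1)]) (use assms(2) in \<open>auto intro: rtrancl_into_rtrancl\<close>)
  then show ?thesis using assms(3) by blast
qed

text \<open>A forest given by depths \<open>d\<close> and parents \<open>p\<close>; the value of \<open>p\<close> at a root is irrelevant.\<close>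

locale layered_tree =
  fixes E :: "('a \<times> 'a) set" and d :: "'a \<Rightarrow> nat" and p :: "'a \<Rightarrow> 'a"
  assumes edge: "(x, y) \<in> E \<Longrightarrow> p x = y \<and> d x = Suc (d y) \<or> p y = x \<and> d y = Suc (d x)"
begin

text \<open>Take a vertex of \<open>C\<close> from which no step to the parent stays in
  \<open>C\<close>. Its descendants in \<open>C\<close> are closed under adjacency, hence are all of
  \<open>C\<close>. A vertex of minimal depth is of this kind, and comparing depths shows it is the
  only one.\<close>

lemma conn_top:
  assumes C: "conn E C"
  obtains t where "t \<in> C" "\<And>x. x \<in> C \<Longrightarrow> x \<noteq> t \<Longrightarrow> p x \<in> C \<and> d x = Suc (d (p x))"
    "\<And>x. x \<in> C \<Longrightarrow> \<exists>i. (p ^^ i) x = t \<and> d x = d t + i"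
proof -
  \<comment> \<open>The depth equation is part of the condition because \<open>p\<close> carries no
    information at a root.\<close>
  define bad where "bad x \<longleftrightarrow> \<not> (p x \<in> C \<and> d x = Suc (d (p x)))" for x
  have below: "\<exists>i. (p ^^ i) y = x \<and> d y = d x + i" if "x \<in> C" "bad x" "y \<in> C" for x y
  proof -
    let ?D = "{y\<in>C. \<exists>i. (p ^^ i) y = x \<and> d y = d x + i}"
    have "?D = C"
    proof (rule connD[OF C])
      show "?D \<noteq> {}" using \<open>x \<in> C\<close> by force
      show "E `` ?D \<inter> C \<subseteq> ?D"
      proof
        fix w assume "w \<in> E `` ?D \<inter> C"
        then obtain y i where *: "(y, w) \<in> E" "w \<in> C" "(p ^^ i) y = x" "d y = d x + i" by blast
        have "\<exists>j. (p ^^ j) w = x \<and> d w = d x + j"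
          using edge[OF *(1)]
        proof (elim disjE conjE)
          assume w: "p w = y" "d w = Suc (d y)"
          have "(p ^^ Suc i) w = (p ^^ i) (p w)"
            by (simp only: funpow_Suc_right o_apply)
          then show ?thesis using * w by (intro exI[of _ "Suc i"]) simp
        next
          assume w: "p y = w" "d y = Suc (d w)"
          show ?thesis
          \<comment> \<open>Moving to the parent shortens the climb to \<open>x\<close> by one. For
            \<open>i = 0\<close> the move would go from \<open>x\<close> itself to a parent in
            \<open>C\<close>, which \<open>bad x\<close> forbids.\<close>
          proof (cases i)
            case 0
            then have "y = x" using *(3) by simp
            then show ?thesis using w *(2) \<open>bad x\<close> unfolding bad_def by blast
          next
            case (Suc j)
            have "(p ^^ Suc j) y = (p ^^ j) (p y)"
              by (simp only: funpow_Suc_right o_apply)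
            then show ?thesis using w * Suc by (intro exI[of _ j]) simp
          qed
        qed
        then show "w \<in> ?D" using *(2) by blast
      qed
    qed auto
    then show ?thesis using \<open>y \<in> C\<close> by blast
  qed
  define t where "t = arg_min d (\<lambda>x. x \<in> C)"
  have "\<exists>x. x \<in> C" using conn_nonempty[OF C] by blast
  then have t: "t \<in> C" "\<And>x. x \<in> C \<Longrightarrow> d t \<le> d x"
    unfolding t_def by (auto intro: arg_min_natI arg_min_nat_le)
  have bad_t: "bad t"
  proof (rule ccontr)
    assume "\<not> bad t"
    then have "p t \<in> C" "d t = Suc (d (p t))" unfolding bad_def by simp_all
    then show False using t(2)[of "p t"] by simp
  qed
  have not_bad: "\<not> bad x" if x: "x \<in> C" "x \<noteq> t" for x
  proof
    assume "bad x"
    then obtain i where "(p ^^ i) t = x" "d t = d x + i" using below[OF x(1) \<open>bad x\<close> t(1)] by blast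
    then show False using t(2)[OF x(1)] x(2) by auto
  qed
  show thesis
  proof (rule that[of t])
    show "p x \<in> C \<and> d x = Suc (d (p x))" if "x \<in> C" "x \<noteq> t" for x
      using not_bad[OF that] unfolding bad_def by blast
  qed (fact t(1), rule below[OF t(1) bad_t])
qed

text \<open>The deepest of the top vertices is common to all sets. A vertex shared by
  \<open>C m\<close> and \<open>C i\<close> climbs to \<open>t m\<close>, and since
  \<open>t i\<close> is no deeper than \<open>t m\<close>, the climb stays inside
  \<open>C i\<close>.\<close>

lemma helly:
  assumes fin: "finite I" "I \<noteq> {}" and C: "\<And>i. i \<in> I \<Longrightarrow> conn E (C i)"
    and int: "\<And>i j. i \<in> I \<Longrightarrow> j \<in> I \<Longrightarrow> C i \<inter> C j \<noteq> {}"
  obtains v where "\<And>i. i \<in> I \<Longrightarrow> v \<in> C i"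
proof -
  have "\<exists>t. \<forall>i\<in>I. (\<forall>x\<in>C i. x \<noteq> t i \<longrightarrow> p x \<in> C i \<and> d x = Suc (d (p x))) \<and>
      (\<forall>x\<in>C i. \<exists>n. (p ^^ n) x = t i \<and> d x = d (t i) + n)"
  proof (rule bchoice, rule ballI)
    fix i assume "i \<in> I"
    then have "conn E (C i)" by (rule C)
    then show "\<exists>t. (\<forall>x\<in>C i. x \<noteq> t \<longrightarrow> p x \<in> C i \<and> d x = Suc (d (p x))) \<and>
      (\<forall>x\<in>C i. \<exists>n. (p ^^ n) x = t \<and> d x = d t + n)"
      by (rule conn_top) blast
  qed
  then obtain t where t: "\<And>i x. i \<in> I \<Longrightarrow> x \<in> C i \<Longrightarrow> x \<noteq> t i \<Longrightarrow> p x \<in> C i \<and> d x = Suc (d (p x))"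
    "\<And>i x. i \<in> I \<Longrightarrow> x \<in> C i \<Longrightarrow> \<exists>n. (p ^^ n) x = t i \<and> d x = d (t i) + n"
    by blast
  have up: "(p ^^ n) x \<in> C i \<and> d x = d ((p ^^ n) x) + n"
    if "i \<in> I" "x \<in> C i" "d (t i) + n \<le> d x" for i x n
    using that(3)
  proof (induct n)
    case (Suc n)
    then have IH: "(p ^^ n) x \<in> C i" "d x = d ((p ^^ n) x) + n" by auto
    then have "(p ^^ n) x \<noteq> t i" using Suc.prems by auto
    then show ?case using t(1)[OF that(1) IH(1)] IH(2) by simp
  qed (use that in simp)
  obtain m where m: "m \<in> I" "\<And>i. i \<in> I \<Longrightarrow> d (t i) \<le> d (t m)"
  proof -
    have "finite ((\<lambda>i. d (t i)) ` I)" "(\<lambda>i. d (t i)) ` I \<noteq> {}" using fin by auto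
    from Max_in[OF this] Max_ge[OF this(1)] show ?thesis using that by auto
  qed
  show thesis
  proof (rule that)
    fix i assume i: "i \<in> I"
    obtain x where x: "x \<in> C m" "x \<in> C i" using int[OF m(1) i] by blast
    obtain n where n: "(p ^^ n) x = t m" "d x = d (t m) + n" using t(2)[OF m(1) x(1)] by blast
    show "t m \<in> C i" using up[OF i x(2), of n] n m(2)[OF i] by simp
  qed
qed

end

section \<open>Rooting a tree\<close>

text \<open>Depth is the distance from \<open>z\<close> and the parent is a neighbour one step
  closer; acyclicity makes every edge a parent edge. The clause on walks is the form in which the
  radius later bounds the depths.\<close>

lemma tree_layering:
  assumes T: "is_tree T" and z: "z \<in> pverts T"
  shows "\<exists>d p. layered_tree (parcs T) d p \<and> (\<forall>v i. (z, v) \<in> parcs T ^^ i \<longrightarrow> d v \<le> i)"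
proof -
  have G: "pair_graph T" and con: "Digraph_Component.connected (with_proj T)"
    and acyc: "\<And>p. pre_digraph.cycle (with_proj T) p \<Longrightarrow> length p < 3"
    using T unfolding is_tree_def by (auto simp: not_le)
  interpret pair_graph T by fact
  let ?E = "parcs T"
  have "conn ?E (pverts T)"
  proof (rule connected_imp_conn[OF G])
    have "with_proj T \<restriction> pverts T = with_proj T"
      by (auto simp: induce_subgraph_def with_proj_def intro: wellformed')
    then show "Digraph_Component.connected (with_proj T \<restriction> pverts T)"
      using con by simp
  qed
  from conn_imp_rtrancl[OF this z] have reach: "\<exists>i. (z, v) \<in> ?E ^^ i" if "v \<in> pverts T" for v
    using that by (simp add: rtrancl_power)
  define d where "d v = (LEAST i. (z, v) \<in> ?E ^^ i)" for v
  have d_le: "d v \<le> i" if "(z, v) \<in> ?E ^^ i" for v i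
    unfolding d_def using that by (rule Least_le)
  have d_walk: "(z, v) \<in> ?E ^^ d v" if "v \<in> pverts T" for v
    unfolding d_def using reach[OF that] by (rule LeastI_ex)
  have "\<exists>u. (u, v) \<in> ?E \<and> d v = Suc (d u)" if v: "v \<in> pverts T" "v \<noteq> z" for v
  proof (cases "d v")
    case 0
    then show ?thesis using d_walk[OF v(1)] v(2) by simp
  next
    case (Suc i)
    then obtain u where u: "(z, u) \<in> ?E ^^ i" "(u, v) \<in> ?E"
      using d_walk[OF v(1)] by auto
    have "(z, v) \<in> ?E ^^ Suc (d u)"
      using d_walk[of u] u(2) in_arcsD1 by auto
    then have "d v = Suc (d u)" using d_le[OF u(1)] d_le[of v "Suc (d u)"] Suc by simp
    then show ?thesis using u(2) by blast
  qed
  then have "\<exists>p. \<forall>v\<in>pverts T - {z}. (p v, v) \<in> ?E \<and> d v = Suc (d (p v))"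
    by (intro bchoice) auto
  then obtain p where p: "\<And>v. v \<in> pverts T \<Longrightarrow> v \<noteq> z \<Longrightarrow> (p v, v) \<in> ?E"
    "\<And>v. v \<in> pverts T \<Longrightarrow> v \<noteq> z \<Longrightarrow> d v = Suc (d (p v))"
    by auto
  define F where "F = (\<Union>v\<in>pverts T - {z}. {(v, p v), (p v, v)})"
  have FE: "F \<subseteq> ?E" unfolding F_def using p(1) by (auto intro: arcs_symmetric)
  have symF: "sym F" unfolding F_def sym_def by blast
  define T' where "T' = \<lparr>pverts = pverts T, parcs = F\<rparr>"
  interpret T': pair_wf_digraph T'
    using FE by unfold_locales (auto simp: T'_def dest!: subsetD intro: in_arcsD1 in_arcsD2)
  have root: "(v, z) \<in> rtrancl_on (pverts T) F" if "v \<in> pverts T" for v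
    using that
  proof (induct "d v" arbitrary: v rule: less_induct)
    case less
    show ?case
    proof (cases "v = z")
      case False
      have "p v \<in> pverts T" using p(1)[OF less.prems False] in_arcsD1 by blast
      moreover have "(v, p v) \<in> F" unfolding F_def using less.prems False by blast
      ultimately show ?thesis
        using less.hyps[of "p v"] p(2)[OF less.prems False] less.prems
        by (intro converse_rtrancl_on_into_rtrancl_on[of v "p v"]) auto
    qed (use less.prems in auto)
  qed
  \<comment> \<open>The arcs \<open>F\<close> to and from parents span, so any further edge would close a cycle.\<close>
  have FF: "(x, y) \<in> F" if xy: "(x, y) \<in> ?E" for x y
  proof (rule ccontr)
    assume not: "(x, y) \<notin> F"
    have V: "x \<in> pverts T" "y \<in> pverts T" using xy wellformed' by blast+
    have "F\<inverse> = F" using symF by (simp add: sym_conv_converse_eq)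
    then have "(z, y) \<in> rtrancl_on (pverts T) F"
      using rtrancl_on_converseI[OF root[OF V(2)]] by simp
    then have "(x, y) \<in> rtrancl_on (pverts T) F"
      using root[OF V(1)] rtrancl_on_trans by metis
    then have "x \<rightarrow>\<^sup>*\<^bsub>with_proj T'\<^esub> y"
      unfolding reachable_def by (simp add: T'_def)
    then obtain w where w: "T'.apath x w y"
      using T'.reachable_apath by blast
    have w': "set w \<subseteq> F" "pcas x w y" "distinct (pawalk_verts x w)"
      using w unfolding T'.apath_def T'.awalk_def by (auto simp: T'_def)
    \<comment> \<open>An empty path would make \<open>(x, y)\<close> a loop, and a path of one arc
      would put \<open>(x, y)\<close> into \<open>F\<close>. Closing up with \<open>(y, x)\<close>
      therefore gives length at least 3.\<close>
    have len: "2 \<le> length w"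
    proof (rule ccontr)
      assume "\<not> 2 \<le> length w"
      then consider "w = []" | e where "w = [e]"
        by (cases w; cases "tl w") auto
      then show False
      proof cases
        case 1
        then show False using w'(2) no_loops' xy by auto
      next
        case 2
        then show False using w' not by (cases e) auto
      qed
    qed
    have aw: "awalk x w y"
      using w' FE V unfolding awalk_def by auto
    have "awalk x (w @ [(y, x)]) x"
      using aw xy V by (intro awalk_appendI) (auto simp: awalk_def intro: arcs_symmetric)
    moreover have "pawalk_verts u (w @ [(y, x)]) = pawalk_verts u w @ [x]" if "pcas u w y" for u
      using that by (induct w arbitrary: u) auto
    note this[OF w'(2)]
    moreover have "pawalk_verts x w = x # tl (pawalk_verts x w)"
      using w'(2) by (cases w) auto
    \<comment> \<open>Dropping the first entry of the closed vertex list leaves a rotation of the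
      vertex list of the path.\<close>
    then have "distinct (tl (pawalk_verts x w @ [x]))"
      using w'(3) by (metis distinct.simps(2) distinct1_rotate list.sel(3) rotate1.simps(2) append_Cons)
    ultimately have "cycle (w @ [(y, x)])"
      unfolding cycle_def by (intro exI[of _ x]) simp
    then show False using acyc[of "w @ [(y, x)]"] len by simp
  qed
  have "layered_tree ?E d p"
  proof
    fix x y assume "(x, y) \<in> ?E"
    from FF[OF this] show "p x = y \<and> d x = Suc (d y) \<or> p y = x \<and> d y = Suc (d x)"
      unfolding F_def using p(2) by auto
  qed
  then show ?thesis using d_le by blast
qed

text \<open>Instead of showing that the infima in \<open>radius\<close> and in the distance are
  attained, \<open>r\<close> is relaxed to the strict bound \<open>r + 1\<close>, which yields
  witnesses for both. Integrality of walk lengths then brings the bound back to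
  \<open>r\<close>.\<close>

lemma radius_le_imp_centre:
  assumes T: "pair_graph T" and r: "radius T \<le> ereal (real r)"
  shows "\<exists>z\<in>pverts T. \<forall>v\<in>pverts T. \<exists>i\<le>r. (z, v) \<in> parcs T ^^ i"
proof -
  interpret pair_graph T by fact
  have walk: "(u, v) \<in> parcs T ^^ length w" if "awalk u w v" for u w v
    using that
  proof (induct w arbitrary: u)
    case (Cons e w)
    then have "(u, snd e) \<in> parcs T" "(snd e, v) \<in> parcs T ^^ length w"
      by (auto simp: awalk_simps)
    then show ?case unfolding length_Cons by (rule relpow_Suc_I2)
  qed (simp add: awalk_simps)
  have "radius T < ereal (real r + 1)"
    using r by (rule order.strict_trans1) simp
  then obtain z where z: "z \<in> pverts T" "(SUP v\<in>pverts T. graph_dist T z v) < ereal (real r + 1)"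
    unfolding radius_def INF_less_iff by blast
  have "\<exists>i\<le>r. (z, v) \<in> parcs T ^^ i" if "v \<in> pverts T" for v
  proof -
    have "graph_dist T z v < ereal (real r + 1)"
      using SUP_lessD[OF z(2) that] .
    then obtain w where w: "awalk z w v" "awalk_cost (\<lambda>_. 1) w < real r + 1"
      unfolding graph_dist_def \<mu>_def INF_less_iff by auto
    have "awalk_cost (\<lambda>_. 1) w = real (length w)"
      by (induct w) auto
    then show ?thesis using walk[OF w(1)] w(2) by (intro exI[of _ "length w"]) auto
  qed
  then show ?thesis using z(1) by blast
qed

section \<open>Grid minors\<close>

text \<open>The host enters through its arcs only, so one notion covers all hosts; containment of
  the branch sets in the vertex set is carried as a separate hypothesis.\<close>

definition minor_model :: "'h pair_pre_digraph \<Rightarrow> ('g \<times> 'g) set \<Rightarrow> ('h \<Rightarrow> 'g set) \<Rightarrow> bool" where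
  "minor_model P E M \<longleftrightarrow> (\<forall>x\<in>pverts P. conn E (M x)) \<and>
     (\<forall>x\<in>pverts P. \<forall>y\<in>pverts P. x \<noteq> y \<longrightarrow> M x \<inter> M y = {}) \<and>
     (\<forall>x y. (x, y) \<in> parcs P \<longrightarrow> (\<exists>u\<in>M x. \<exists>v\<in>M y. (u, v) \<in> E))"

lemma minor_modelD:
  assumes "minor_model P E M"
  shows "x \<in> pverts P \<Longrightarrow> conn E (M x)"
    and "x \<in> pverts P \<Longrightarrow> y \<in> pverts P \<Longrightarrow> x \<noteq> y \<Longrightarrow> M x \<inter> M y = {}"
    and "(x, y) \<in> parcs P \<Longrightarrow> \<exists>u\<in>M x. \<exists>v\<in>M y. (u, v) \<in> E"
  using assms unfolding minor_model_def by blast+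

lemma is_minor_imp_minor_model:
  assumes "pair_graph G" "is_minor P G"
  obtains M where "minor_model P (parcs G) M" "\<And>x. x \<in> pverts P \<Longrightarrow> M x \<subseteq> pverts G"
proof -
  from assms(2) obtain M where M:
    "\<forall>x\<in>pverts P. M x \<subseteq> pverts G \<and> Digraph_Component.connected (with_proj G \<restriction> M x)"
    "\<forall>x\<in>pverts P. \<forall>y\<in>pverts P. x \<noteq> y \<longrightarrow> M x \<inter> M y = {}"
    "\<forall>(x, y)\<in>parcs P. \<exists>u\<in>M x. \<exists>v\<in>M y. (u, v) \<in> parcs G"
    unfolding is_minor_def by (elim exE conjE)
  have "minor_model P (parcs G) M"
    unfolding minor_model_def using M connected_imp_conn[OF assms(1)] by fast
  then show thesis using that M(1) by blast
qed

lemma conn_model_UN: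
  assumes M: "minor_model P E M" and X: "conn (parcs P) X" "X \<subseteq> pverts P"
  shows "conn E (\<Union>x\<in>X. M x)"
proof (rule conn_UN[OF X(1)])
  show "conn E (M x)" if "x \<in> X" for x
    using that minor_modelD(1)[OF M] X(2) by blast
  show "\<exists>u\<in>M x. \<exists>v\<in>M y. u = v \<or> (u, v) \<in> E" if "(x, y) \<in> parcs P" for x y
    using minor_modelD(3)[OF M that] by blast
qed

text \<open>Transitivity of the minor relation: it carries a subgrid found inside the grid over to
  the product.\<close>

lemma minor_model_comp:
  assumes N: "minor_model P (parcs Q) N" "\<And>x. x \<in> pverts P \<Longrightarrow> N x \<subseteq> pverts Q"
    and M: "minor_model Q E M"
  shows "minor_model P E (\<lambda>x. \<Union>y\<in>N x. M y)"
  unfolding minor_model_def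
proof (intro conjI ballI allI impI)
  fix x assume "x \<in> pverts P"
  then show "conn E (\<Union>y\<in>N x. M y)"
    using conn_model_UN[OF M] minor_modelD(1)[OF N(1)] N(2) by blast
next
  fix x y assume xy: "x \<in> pverts P" "y \<in> pverts P" "x \<noteq> y"
  show "(\<Union>y\<in>N x. M y) \<inter> (\<Union>x\<in>N y. M x) = {}"
    using minor_modelD(2)[OF N(1) xy] minor_modelD(2)[OF M] N(2)[OF xy(1)] N(2)[OF xy(2)] by blast
next
  fix x y assume "(x, y) \<in> parcs P"
  then obtain a b where "a \<in> N x" "b \<in> N y" "(a, b) \<in> parcs Q"
    using minor_modelD(3)[OF N(1)] by blast
  then show "\<exists>u\<in>\<Union>y\<in>N x. M y. \<exists>v\<in>\<Union>x\<in>N y. M x. (u, v) \<in> E"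
    using minor_modelD(3)[OF M] by blast
qed

text \<open>Branch sets are disjoint, so choosing a vertex of \<open>Z\<close> in each one that is
  hit is injective. Applied to a bag it brings in the treewidth, applied to a copy of
  \<open>H\<close> the number of vertices.\<close>

lemma card_branch_sets_hit_le:
  assumes M: "minor_model P E M" and Z: "finite Z"
  shows "card {x\<in>pverts P. M x \<inter> Z \<noteq> {}} \<le> card Z"
proof -
  let ?X = "{x\<in>pverts P. M x \<inter> Z \<noteq> {}}"
  define f where "f x = (SOME u. u \<in> M x \<inter> Z)" for x
  have f: "f x \<in> M x \<inter> Z" if "x \<in> ?X" for x
    unfolding f_def by (rule someI_ex) (use that in blast)
  have "inj_on f ?X"
  proof (rule inj_onI, rule ccontr)
    fix x y assume xy: "x \<in> ?X" "y \<in> ?X" "f x = f y" "x \<noteq> y"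
    then have "M x \<inter> M y = {}" using minor_modelD(2)[OF M] by blast
    then show False using f[OF xy(1)] f[OF xy(2)] xy(3) by auto
  qed
  then show ?thesis
    using f Z by (intro card_inj_on_le[of f]) blast+
qed

section \<open>Connected pieces of the grid\<close>

lemma pverts_grid: "pverts (grid k) = {1..k} \<times> {1..k}"
  by (simp add: grid_def)

lemma conn_interval:
  assumes "a \<le> b"
  shows "conn {(i, j). j = Suc i \<or> i = Suc j} {a..b}"
  using assms
proof (induct b rule: dec_induct)
  case base
  then show ?case by (simp add: conn_singleton)
next
  case (step b)
  have "conn {(i, j). j = Suc i \<or> i = Suc j} {b, Suc b}"
    unfolding conn_def by auto
  then have "conn {(i, j). j = Suc i \<or> i = Suc j} ({a..b} \<union> {b, Suc b})"
    by (rule conn_Un[OF step(3), of _ b]) (use step in auto)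
  moreover have "{a..b} \<union> {b, Suc b} = {a..Suc b}" using step by auto
  ultimately show ?case by simp
qed

lemma conn_row:
  assumes "i \<in> {1..k}" "a \<le> b" "{a..b} \<subseteq> {1..k}"
  shows "conn (parcs (grid k)) ({i} \<times> {a..b})"
proof -
  have "conn (parcs (grid k)) ((\<lambda>j. (i, j)) ` {a..b})"
    by (rule conn_image[OF conn_interval[OF assms(2)]]) (use assms in \<open>auto simp: grid_def\<close>)
  moreover have "(\<lambda>j. (i, j)) ` {a..b} = {i} \<times> {a..b}" by auto
  ultimately show ?thesis by simp
qed

lemma conn_column:
  assumes "j \<in> {1..k}" "a \<le> b" "{a..b} \<subseteq> {1..k}"
  shows "conn (parcs (grid k)) ({a..b} \<times> {j})"
proof -
  have "conn (parcs (grid k)) ((\<lambda>i. (i, j)) ` {a..b})"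
    by (rule conn_image[OF conn_interval[OF assms(2)]]) (use assms in \<open>auto simp: grid_def\<close>)
  moreover have "(\<lambda>i. (i, j)) ` {a..b} = {a..b} \<times> {j}" by auto
  ultimately show ?thesis by simp
qed

lemma conn_grid:
  assumes "1 \<le> k"
  shows "conn (parcs (grid k)) (pverts (grid k))"
proof -
  have "conn (parcs (grid k)) (\<Union>i\<in>{1..k}. {i} \<times> {1..k})"
  proof (rule conn_UN[OF conn_interval[OF assms]])
    fix i j assume "i \<in> {1..k}" "j \<in> {1..k}" "(i, j) \<in> {(i, j). j = Suc i \<or> i = Suc j}"
    then have "((i, 1), (j, 1)) \<in> parcs (grid k)" using assms by (auto simp: grid_def)
    then show "\<exists>u\<in>{i} \<times> {1..k}. \<exists>v\<in>{j} \<times> {1..k}. u = v \<or> (u, v) \<in> parcs (grid k)"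
      using assms by fastforce
  qed (use assms conn_row in auto)
  moreover have "(\<Union>i\<in>{1..k}. {i} \<times> {1..k}) = pverts (grid k)"
    by (auto simp: pverts_grid)
  ultimately show ?thesis by simp
qed

section \<open>Crosses and the bramble argument\<close>

definition cross :: "nat \<Rightarrow> nat \<times> nat \<Rightarrow> (nat \<times> nat) set" where
  "cross k c = {fst c} \<times> {1..k} \<union> {1..k} \<times> {snd c}"

lemma cross_subset: "c \<in> pverts (grid k) \<Longrightarrow> cross k c \<subseteq> pverts (grid k)"
  by (auto simp: cross_def pverts_grid)

lemma conn_cross:
  assumes "c \<in> pverts (grid k)"
  shows "conn (parcs (grid k)) (cross k c)"
proof -
  obtain i j where c: "c = (i, j)" "i \<in> {1..k}" "j \<in> {1..k}"
    using assms by (auto simp: pverts_grid)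
  then have "1 \<le> k" by simp
  have "conn (parcs (grid k)) ({i} \<times> {1..k} \<union> {1..k} \<times> {j})"
    by (rule conn_Un[OF conn_row conn_column, of _ _ _ _ _ _ _ "(i, j)"])
      (use c(2,3) \<open>1 \<le> k\<close> in auto)
  then show ?thesis by (simp add: cross_def c(1))
qed

lemma cross_Int_nonempty:
  assumes "c \<in> pverts (grid k)" "c' \<in> pverts (grid k)"
  shows "cross k c \<inter> cross k c' \<noteq> {}"
proof -
  have "(fst c, snd c') \<in> cross k c \<inter> cross k c'"
    using assms by (auto simp: cross_def pverts_grid)
  then show ?thesis by blast
qed

text \<open>Fewer than \<open>k\<close> vertices miss some row \<open>i\<close> and some column
  \<open>j\<close> entirely, and hence the cross at \<open>(i, j)\<close>.\<close>

lemma cross_hitting_set_ge: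
  assumes "finite X" and hit: "\<And>c. c \<in> pverts (grid k) \<Longrightarrow> cross k c \<inter> X \<noteq> {}"
  shows "k \<le> card X"
proof (rule ccontr)
  assume "\<not> k \<le> card X"
  then have less: "card (f ` X) < card {1..k}" for f :: "nat \<times> nat \<Rightarrow> nat"
    using card_image_le[OF assms(1), of f] by simp
  have "\<exists>i\<in>{1..k}. i \<notin> f ` X" for f :: "nat \<times> nat \<Rightarrow> nat"
    using card_mono[of "f ` X" "{1..k}"] less[of f] assms(1) by (meson finite_imageI leD subsetI)
  then obtain i j where "i \<in> {1..k}" "i \<notin> fst ` X" "j \<in> {1..k}" "j \<notin> snd ` X"
    by metis
  then show False
    using hit[of "(i, j)"] by (force simp: cross_def pverts_grid image_iff)
qed

text \<open>The crosses form a bramble; the Helly property provides a node that covers it.\<close>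

lemma (in layered_tree) grid_order_le:
  assumes con: "\<And>c. c \<in> pverts (grid k) \<Longrightarrow> conn E (\<Union>x\<in>cross k c. f x)"
    and ne: "\<And>x. x \<in> pverts (grid k) \<Longrightarrow> f x \<noteq> {}"
    and w: "\<And>v c. c \<in> pverts (grid k) \<Longrightarrow> v \<in> (\<Union>x\<in>cross k c. f x) \<Longrightarrow>
      card {x\<in>pverts (grid k). v \<in> f x} \<le> w"
  shows "k \<le> w"
proof (cases "k = 0")
  case False
  then have one: "(1, 1) \<in> pverts (grid k)" by (simp add: pverts_grid)
  have "\<exists>v. \<forall>c\<in>pverts (grid k). v \<in> (\<Union>x\<in>cross k c. f x)"
  proof (rule helly[of "pverts (grid k)" "\<lambda>c. \<Union>x\<in>cross k c. f x"])
    fix c c' assume c: "c \<in> pverts (grid k)" "c' \<in> pverts (grid k)"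
    then obtain x where "x \<in> cross k c" "x \<in> cross k c'" using cross_Int_nonempty by blast
    then show "(\<Union>x\<in>cross k c. f x) \<inter> (\<Union>x\<in>cross k c'. f x) \<noteq> {}"
      using ne[of x] cross_subset[OF c(1)] by blast
  qed (use con one in \<open>auto simp: pverts_grid\<close>)
  then obtain v where v: "\<And>c. c \<in> pverts (grid k) \<Longrightarrow> v \<in> (\<Union>x\<in>cross k c. f x)" by blast
  \<comment> \<open>The grid vertices whose trace contains the covering node form a hitting set for
    the crosses.\<close>
  have "k \<le> card {x\<in>pverts (grid k). v \<in> f x}"
  proof (rule cross_hitting_set_ge)
    fix c assume c: "c \<in> pverts (grid k)"
    then show "cross k c \<inter> {x\<in>pverts (grid k). v \<in> f x} \<noteq> {}"
      using v[OF c] cross_subset[OF c] by blast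
  qed (simp add: pverts_grid)
  \<comment> \<open>The bound \<open>w\<close> is available only at nodes met by some cross; the
    node \<open>v\<close> is met by all of them, in particular by the cross at
    \<open>(1, 1)\<close>.\<close>
  also have "\<dots> \<le> w" using w[OF one v[OF one]] .
  finally show ?thesis .
qed simp

section \<open>Subgrids avoiding a small set\<close>

text \<open>The first \<open>g\<close> elements of \<open>I\<close> in increasing order cut out
  consecutive intervals, each starting at a chosen element and ending just before the next. Bounding
  each end by an element of \<open>I\<close> keeps the intervals inside any interval that contains
  \<open>I\<close>.\<close>

lemma increasing_segments:
  fixes I :: "nat set"
  assumes "finite I" "g \<le> card I"
  obtains r s where "\<And>i. i \<in> {1..g} \<Longrightarrow> r i \<in> I \<and> r i \<le> s i \<and> (\<exists>y\<in>I. s i \<le> y)"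
    "\<And>i. 1 \<le> i \<Longrightarrow> i < g \<Longrightarrow> r (Suc i) = Suc (s i)"
    "\<And>i j. i \<in> {1..g} \<Longrightarrow> j \<in> {1..g} \<Longrightarrow> i < j \<Longrightarrow> s i < r j"
proof -
  obtain h :: "nat \<Rightarrow> nat" where h: "strict_mono_on {..<card I} h" "\<And>n. n < card I \<Longrightarrow> h n \<in> I"
    using finite_enumerate[OF assms(1)] by blast
  have less: "h i < h j" if "i < j" "j < g" for i j
    using h(1) that assms(2) by (auto simp: strict_mono_on_def)
  \<comment> \<open>The enumeration \<open>h\<close> counts from 0, grid coordinates from 1. The
    last segment is a single point, since there may be no further element of \<open>I\<close> to
    stop at.\<close>
  define r where "r i = h (i - 1)" for i
  define s where "s i = (if i < g then h i - 1 else h (i - 1))" for i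
  have r: "r i \<in> I" if "i \<in> {1..g}" for i
    unfolding r_def using that assms(2) by (intro h(2)) auto
  show thesis
  proof (rule that[of r s])
    fix i assume i: "i \<in> {1..g}"
    have "r i \<le> s i \<and> (\<exists>y\<in>I. s i \<le> y)"
    proof (cases "i < g")
      case True
      then show ?thesis
        using less[of "i - 1" i] h(2)[of i] i assms(2) by (auto simp: r_def s_def intro!: bexI[of _ "h i"])
    next
      case False
      then show ?thesis using r[OF i] by (auto simp: r_def s_def)
    qed
    then show "r i \<in> I \<and> r i \<le> s i \<and> (\<exists>y\<in>I. s i \<le> y)" using r[OF i] by blast
  next
    fix i assume "1 \<le> i" "i < g"
    then show "r (Suc i) = Suc (s i)" using less[of "i - 1" i] by (simp add: r_def s_def)
  next
    fix i j assume ij: "i \<in> {1..g}" "j \<in> {1..g}" "i < j"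
    then have "h i \<le> h (j - 1)"
      using less[of i "j - 1"] by (cases "i = j - 1") (auto intro: less_imp_le)
    then show "s i < r j" using ij less[of "i - 1" i] by (auto simp: r_def s_def)
  qed
qed

text \<open>
  Rows and columns of the block that miss \<open>X\<close> form a subdivided grid; an L-shaped
  piece around each crossing, up to the next chosen row and column, serves as branch set.
\<close>

lemma grid_avoiding:
  assumes A: "{a<..a + m} \<subseteq> {1..k}" and B: "{b<..b + m} \<subseteq> {1..k}" and fin: "finite X"
    and card: "card (X \<inter> {a<..a + m} \<times> {b<..b + m}) + g \<le> m"
  obtains N where "minor_model (grid g) (parcs (grid k)) N"
    "\<And>x. x \<in> pverts (grid g) \<Longrightarrow> N x \<subseteq> {a<..a + m} \<times> {b<..b + m} - X"
proof -
  let ?A = "{a<..a + m}" and ?B = "{b<..b + m}"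
  let ?Z = "X \<inter> ?A \<times> ?B"
  define I J where "I = ?A - fst ` ?Z" and "J = ?B - snd ` ?Z"
  have finZ: "finite ?Z" using fin by blast
  \<comment> \<open>Each vertex of \<open>X\<close> in the block spoils one row and one column, so
    at least \<open>g\<close> rows and \<open>g\<close> columns stay free.\<close>
  have "g \<le> card I"
    unfolding I_def using diff_card_le_card_Diff[of "fst ` ?Z" ?A] card_image_le[OF finZ, of fst] card finZ
    by simp
  then obtain r s where rs: "\<And>i. i \<in> {1..g} \<Longrightarrow> r i \<in> I \<and> r i \<le> s i \<and> (\<exists>y\<in>I. s i \<le> y)"
    "\<And>i. 1 \<le> i \<Longrightarrow> i < g \<Longrightarrow> r (Suc i) = Suc (s i)"
    "\<And>i j. i \<in> {1..g} \<Longrightarrow> j \<in> {1..g} \<Longrightarrow> i < j \<Longrightarrow> s i < r j"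
    using increasing_segments[of I g] unfolding I_def by auto
  have "g \<le> card J"
    unfolding J_def using diff_card_le_card_Diff[of "snd ` ?Z" ?B] card_image_le[OF finZ, of snd] card finZ
    by simp
  then obtain c d where cd: "\<And>i. i \<in> {1..g} \<Longrightarrow> c i \<in> J \<and> c i \<le> d i \<and> (\<exists>y\<in>J. d i \<le> y)"
    "\<And>i. 1 \<le> i \<Longrightarrow> i < g \<Longrightarrow> c (Suc i) = Suc (d i)"
    "\<And>i j. i \<in> {1..g} \<Longrightarrow> j \<in> {1..g} \<Longrightarrow> i < j \<Longrightarrow> d i < c j"
    using increasing_segments[of J g] unfolding J_def by auto
  have rsA: "{r i..s i} \<subseteq> ?A" if "i \<in> {1..g}" for i
    using rs(1)[OF that] unfolding I_def by fastforce
  have cdB: "{c i..d i} \<subseteq> ?B" if "i \<in> {1..g}" for i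
    using cd(1)[OF that] unfolding J_def by fastforce
  have rs_disj: "{r i..s i} \<inter> {r j..s j} = {}" if "i \<in> {1..g}" "j \<in> {1..g}" "i \<noteq> j" for i j
    using rs(3)[of i j] rs(3)[of j i] that by (cases "i < j") auto
  have cd_disj: "{c i..d i} \<inter> {c j..d j} = {}" if "i \<in> {1..g}" "j \<in> {1..g}" "i \<noteq> j" for i j
    using cd(3)[of i j] cd(3)[of j i] that by (cases "i < j") auto
  define N where "N = (\<lambda>(i, j). {r i} \<times> {c j..d j} \<union> {r i..s i} \<times> {c j})"
  \<comment> \<open>Disjointness of the L-shapes is inherited from their bounding
    rectangles.\<close>
  have N_rect: "N (i, j) \<subseteq> {r i..s i} \<times> {c j..d j}" if "i \<in> {1..g}" "j \<in> {1..g}" for i j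
    using rs(1)[OF that(1)] cd(1)[OF that(2)] by (auto simp: N_def)
  have corner: "(r i, c j) \<in> N (i, j)" "(s i, c j) \<in> N (i, j)" "(r i, d j) \<in> N (i, j)"
    if "i \<in> {1..g}" "j \<in> {1..g}" for i j
    using rs(1)[OF that(1)] cd(1)[OF that(2)] by (auto simp: N_def)
  have row: "(i, y) \<notin> X" if "i \<in> I" "y \<in> ?B" for i y
    using that by (force simp: I_def image_iff)
  have col: "(x, j) \<notin> X" if "x \<in> ?A" "j \<in> J" for x j
    using that by (force simp: J_def image_iff)
  have "N x \<subseteq> ?A \<times> ?B - X" if x: "x \<in> pverts (grid g)" for x
  proof -
    obtain i j where ij: "x = (i, j)" "i \<in> {1..g}" "j \<in> {1..g}"
      using x by (auto simp: pverts_grid)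
    have "N (i, j) \<subseteq> ?A \<times> ?B"
      using N_rect[OF ij(2,3)] rsA[OF ij(2)] cdB[OF ij(3)] by blast
    \<comment> \<open>Both arms run along a chosen row or column, which misses \<open>X\<close>
      throughout the block.\<close>
    moreover have "N (i, j) \<inter> X = {}"
      using row[of "r i"] col[of _ "c j"] rs(1)[OF ij(2)] cd(1)[OF ij(3)] rsA[OF ij(2)] cdB[OF ij(3)]
      unfolding N_def by fast
    ultimately show ?thesis using ij(1) by blast
  qed
  moreover have "minor_model (grid g) (parcs (grid k)) N"
    unfolding minor_model_def
  proof (intro conjI ballI allI impI)
    fix x assume "x \<in> pverts (grid g)"
    then obtain i j where ij: "x = (i, j)" "i \<in> {1..g}" "j \<in> {1..g}"
      by (auto simp: pverts_grid)
    have "conn (parcs (grid k)) ({r i} \<times> {c j..d j} \<union> {r i..s i} \<times> {c j})"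
    proof (rule conn_Un[OF conn_row conn_column])
      show "r i \<in> {1..k}" "{r i..s i} \<subseteq> {1..k}"
        using rsA[OF ij(2)] rs(1)[OF ij(2)] A by (auto simp: subset_iff)
      show "c j \<in> {1..k}" "{c j..d j} \<subseteq> {1..k}"
        using cdB[OF ij(3)] cd(1)[OF ij(3)] B by (auto simp: subset_iff)
      show "(r i, c j) \<in> ({r i} \<times> {c j..d j}) \<inter> ({r i..s i} \<times> {c j})"
        using rs(1)[OF ij(2)] cd(1)[OF ij(3)] by auto
    qed (use rs(1)[OF ij(2)] cd(1)[OF ij(3)] in auto)
    then show "conn (parcs (grid k)) (N x)" by (simp add: N_def ij(1))
  next
    fix x y assume xy: "x \<in> pverts (grid g)" "y \<in> pverts (grid g)" "x \<noteq> y"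
    then obtain i j i' j' where ij: "x = (i, j)" "i \<in> {1..g}" "j \<in> {1..g}"
      "y = (i', j')" "i' \<in> {1..g}" "j' \<in> {1..g}"
      unfolding pverts_grid by blast
    with xy(3) consider "i \<noteq> i'" | "j \<noteq> j'" by blast
    then have "({r i..s i} \<times> {c j..d j}) \<inter> ({r i'..s i'} \<times> {c j'..d j'}) = {}"
      by cases (use rs_disj[of i i'] cd_disj[of j j'] ij in blast)+
    then show "N x \<inter> N y = {}"
      using N_rect[OF ij(2,3)] N_rect[OF ij(5,6)] ij(1,4) by blast
  next
    have in_grid: "x \<in> {1..k} \<and> y \<in> {1..k}" if "i \<in> {1..g}" "j \<in> {1..g}" "(x, y) \<in> N (i, j)" for i j x y
      using N_rect[OF that(1,2)] rsA[OF that(1)] cdB[OF that(2)] that(3) A B by blast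
    \<comment> \<open>The horizontal arm ends at \<open>d j\<close>, directly before the next chosen
      column \<open>c (Suc j)\<close>; \<open>down\<close> is the analogue for the vertical
      arm.\<close>
    have right: "((r i, d j), (r i, c (Suc j))) \<in> parcs (grid k) \<and> ((r i, c (Suc j)), (r i, d j)) \<in> parcs (grid k)"
      if "i \<in> {1..g}" "j \<in> {1..g}" "Suc j \<in> {1..g}" for i j
      using in_grid[OF that(1,2) corner(3)[OF that(1,2)]] in_grid[OF that(1,3) corner(1)[OF that(1,3)]]
        cd(2)[of j] that by (auto simp: grid_def)
    have down: "((s i, c j), (r (Suc i), c j)) \<in> parcs (grid k) \<and> ((r (Suc i), c j), (s i, c j)) \<in> parcs (grid k)"
      if "i \<in> {1..g}" "j \<in> {1..g}" "Suc i \<in> {1..g}" for i j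
      using in_grid[OF that(1,2) corner(2)[OF that(1,2)]] in_grid[OF that(3,2) corner(1)[OF that(3,2)]]
        rs(2)[of i] that by (auto simp: grid_def)
    fix x y assume "(x, y) \<in> parcs (grid g)"
    then obtain i j i' j' where ij: "x = (i, j)" "i \<in> {1..g}" "j \<in> {1..g}"
      "y = (i', j')" "i' \<in> {1..g}" "j' \<in> {1..g}"
      and "i = i' \<and> (j' = Suc j \<or> j = Suc j') \<or> j = j' \<and> (i' = Suc i \<or> i = Suc i')"
      by (auto simp: grid_def)
    then consider "i = i'" "j' = Suc j" | "i = i'" "j = Suc j'" | "j = j'" "i' = Suc i" | "j = j'" "i = Suc i'"
      by blast
    then show "\<exists>u\<in>N x. \<exists>v\<in>N y. (u, v) \<in> parcs (grid k)"
    proof cases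
      case 1
      then show ?thesis
        using right[of i j] ij by (intro bexI[of _ "(r i, d j)"] bexI[of _ "(r i, c (Suc j))"]) (simp_all add: corner)
    next
      case 2
      then show ?thesis
        using right[of i j'] ij by (intro bexI[of _ "(r i, c (Suc j'))"] bexI[of _ "(r i, d j')"]) (simp_all add: corner)
    next
      case 3
      then show ?thesis
        using down[of i j] ij by (intro bexI[of _ "(s i, c j)"] bexI[of _ "(r (Suc i), c j)"]) (simp_all add: corner)
    next
      case 4
      then show ?thesis
        using down[of i' j] ij by (intro bexI[of _ "(r (Suc i'), c j)"] bexI[of _ "(s i', c j)"]) (simp_all add: corner)
    qed
  qed
  ultimately show thesis using that by blast
qed

section \<open>Counting over blocks and choosing their number\<close>

lemma card_ge_blocks:
  fixes X :: "(nat \<times> nat) set"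
  assumes "finite X"
    and ge: "\<And>i j. i < q \<Longrightarrow> j < q \<Longrightarrow>
      w \<le> card (X \<inter> {i * m<..i * m + m} \<times> {j * m<..j * m + m})"
  shows "q * q * w \<le> card X"
proof -
  let ?S = "\<lambda>i. {i * m<..i * m + m}"
  let ?B = "\<lambda>(i, j). X \<inter> ?S i \<times> ?S j"
  let ?Q = "{..<q} \<times> {..<q}"
  have less: "?S i \<inter> ?S j = {}" if "i < j" for i j
  proof -
    have "i * m + m \<le> j * m" using mult_le_mono1[of "Suc i" j m] that by simp
    then show ?thesis by auto
  qed
  have disj: "?S i \<inter> ?S j = {}" if "i \<noteq> j" for i j
    using less[of i j] less[of j i] that by (cases "i < j") auto
  have "q * q * w = (\<Sum>x\<in>?Q. w)" by simp
  also have "\<dots> \<le> (\<Sum>x\<in>?Q. card (?B x))"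
    by (rule sum_mono) (use ge in auto)
  also have "\<dots> = card (\<Union>x\<in>?Q. ?B x)"
  proof (rule card_UN_disjoint[symmetric])
    show "\<forall>x\<in>?Q. \<forall>y\<in>?Q. x \<noteq> y \<longrightarrow> ?B x \<inter> ?B y = {}"
    proof (intro ballI impI)
      fix x y :: "nat \<times> nat" assume "x \<noteq> y"
      then have "?S (fst x) \<inter> ?S (fst y) = {} \<or> ?S (snd x) \<inter> ?S (snd y) = {}"
        using disj by (metis prod_eqI)
      then show "?B x \<inter> ?B y = {}" by (auto simp: case_prod_beta)
    qed
  qed (use assms(1) in auto)
  also have "\<dots> \<le> card X"
    by (rule card_mono) (use assms(1) in auto)
  finally show ?thesis .
qed

text \<open>For \<open>k <= 5 a\<close> the bound \<open>k <= n\<close> suffices. Otherwise the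
  block inequality is essentially \<open>q k - b q^2 <= n\<close> with \<open>b = a + 1\<close>, and
  its left side peaks at \<open>q = k / (2 b)\<close> with value \<open>k^2 / (4 b)\<close>; the
  rest controls the rounding.\<close>

lemma square_le_of_blocks:
  fixes k n a :: nat
  assumes "k \<le> n" "4 \<le> a" and blocks: "\<And>q. 1 \<le> q \<Longrightarrow> q * q * (k div q - a) \<le> n"
  shows "k * k \<le> 5 * n * a"
proof (cases "k \<le> 5 * a")
  case True
  then have "k * k \<le> n * (5 * a)" using assms(1) by (intro mult_le_mono)
  then show ?thesis by (simp add: mult_ac)
next
  case False
  define b where "b = a + 1"
  \<comment> \<open>The quotient \<open>k / (2 b)\<close> rounded to a nearest integer, so that
    \<open>2 b q\<close> differs from \<open>k\<close> by at most \<open>b\<close>.\<close>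
  define q where "q = (k + b) div (2 * b)"
  have "k + b = 2 * b * q + (k + b) mod (2 * b)" "(k + b) mod (2 * b) < 2 * b"
    unfolding q_def b_def by (simp_all only: mult_div_mod_eq) simp
  then have q_near: "2 * b * q \<le> k + b" "k < 2 * b * q + b" by linarith+
  have "2 * (2 * b) \<le> k + b" using False assms(2) unfolding b_def by simp
  then have q2: "2 \<le> q" unfolding q_def using assms(2) by (simp add: less_eq_div_iff_mult_less_eq b_def)
  define m where "m = k div q"
  have m: "k + 1 \<le> q * m + q"
    using mult_div_mod_eq[of q k] mod_less_divisor[of q k] q2 unfolding m_def by linarith
  let ?k = "int k" and ?q = "int q" and ?m = "int m" and ?a = "int a" and ?b = "int b" and ?n = "int n"
  \<comment> \<open>Truncated subtraction can only enlarge the value, so the hypothesis passes to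
    the integers.\<close>
  have "?q * ?q * (?m - ?a) \<le> int (q * q * (m - a))"
    by (simp add: mult_left_mono)
  also have "\<dots> \<le> ?n" using blocks[of q] q2 unfolding m_def by (simp only: of_nat_le_iff)
  finally have n1: "?q * ?q * (?m - ?a) \<le> ?n" .
  have "int (k + 1) \<le> int (q * m + q)"
    using m by (simp only: of_nat_le_iff)
  then have "?q * (?k + 1) \<le> ?q * (?q * ?m + ?q)"
    by (intro mult_left_mono) simp_all
  \<comment> \<open>The rounding loss in \<open>m = k div q\<close> is what replaces
    \<open>a\<close> by \<open>b = a + 1\<close>.\<close>
  with n1 have n2: "?q * ?k - ?q * ?q * ?b + ?q \<le> ?n"
    unfolding b_def by (simp add: algebra_simps)
  have "int (2 * b * q) \<le> int (k + b)" "int k < int (2 * b * q + b)"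
    using q_near by (simp_all only: of_nat_le_iff of_nat_less_iff)
  then have "\<bar>2 * ?b * ?q - ?k\<bar> \<le> \<bar>?b\<bar>"
    unfolding of_nat_mult of_nat_add of_nat_numeral by linarith
  then have "(2 * ?b * ?q - ?k)\<^sup>2 \<le> ?b\<^sup>2"
    by (simp only: abs_le_square_iff)
  \<comment> \<open>Completing the square: the right-hand side equals
    \<open>k^2 - (2 b q - k)^2 + 4 b q\<close>.\<close>
  then have "?k\<^sup>2 - ?b\<^sup>2 + 4 * ?b * ?q \<le> 4 * ?b * (?q * ?k - ?q * ?q * ?b + ?q)"
    by (simp add: power2_eq_square algebra_simps)
  also have "\<dots> \<le> 4 * ?b * ?n"
    using n2 by (intro mult_left_mono) simp_all
  finally have "?k\<^sup>2 - ?b\<^sup>2 + 4 * ?b * ?q \<le> 4 * ?b * ?n" .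
  moreover have "4 * ?b * 2 \<le> 4 * ?b * ?q"
    using q2 by (intro mult_left_mono) simp_all
  ultimately have n3: "?k\<^sup>2 - ?b\<^sup>2 + 8 * ?b \<le> 4 * ?b * ?n" by linarith
  \<comment> \<open>As \<open>5 a - 4 b = a - 4\<close>, the goal
    \<open>4 b k^2 <= 5 a (k^2 - b^2 + 8 b)\<close> amounts to
    \<open>5 a (b^2 - 8 b) <= (a - 4) k^2\<close>. With \<open>a >= 4\<close> and
    \<open>k > 5 a\<close> it suffices to check this at \<open>k = 5 a\<close>, where the difference
    of the two sides is the product shown here.\<close>
  have "0 \<le> 5 * ?a * (4 * ?a * (?a - 4) + 2 * ?a + 7)"
    using assms(2) by simp
  then have "5 * ?a * (?b\<^sup>2 - 8 * ?b) \<le> (?a - 4) * (5 * ?a)\<^sup>2"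
    unfolding b_def by (simp add: power2_eq_square algebra_simps)
  also have "\<dots> \<le> (?a - 4) * ?k\<^sup>2"
    using False assms(2) by (intro mult_left_mono power_mono) simp_all
  finally have "4 * ?b * ?k\<^sup>2 \<le> 5 * ?a * (?k\<^sup>2 - ?b\<^sup>2 + 8 * ?b)"
    unfolding b_def by (simp add: power2_eq_square algebra_simps)
  also have "\<dots> \<le> 5 * ?a * (4 * ?b * ?n)"
    using n3 by (intro mult_left_mono) simp_all
  finally have "4 * ?b * ?k\<^sup>2 \<le> 4 * ?b * (5 * ?n * ?a)"
    by (simp add: algebra_simps)
  then have "?k\<^sup>2 \<le> 5 * ?n * ?a"
    by (rule mult_left_le_imp_le) (simp add: b_def)
  then have "int (k * k) \<le> int (5 * n * a)" by (simp add: power2_eq_square)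
  then show ?thesis by (simp only: of_nat_le_iff)
qed

section \<open>Lexicographic products with a tree\<close>

lemma optimal_tree_decomposition:
  assumes "pair_graph H"
  obtains S :: "nat pair_pre_digraph" and B
  where "tree_decomposition H S B" "decomposition_width S B = treewidth H"
proof -
  have "\<exists>w (S :: nat pair_pre_digraph) B. tree_decomposition H S B \<and> decomposition_width S B = w"
    using tree_decomposition_exists[OF assms] by blast
  from LeastI_ex[OF this] show thesis
    unfolding treewidth_def[symmetric] using that by blast
qed

text \<open>The trace \<open>f x\<close> consists of the nodes whose bag meets \<open>M x\<close>.
  Adjacent vertices share a bag, so crosses have connected traces, and a node lies in at most as
  many traces as its bag has vertices.\<close>

lemma grid_order_le_treewidth:
  assumes H: "pair_graph H" and M: "minor_model (grid k) (parcs H) M"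
    and sub: "\<And>x. x \<in> pverts (grid k) \<Longrightarrow> M x \<subseteq> pverts H"
  shows "k \<le> treewidth H + 1"
proof -
  obtain S :: "nat pair_pre_digraph" and B
    where SB: "tree_decomposition H S B" "decomposition_width S B = treewidth H"
    by (rule optimal_tree_decomposition[OF H])
  have S: "is_tree S" and bags: "\<And>s. s \<in> pverts S \<Longrightarrow> B s \<subseteq> pverts H"
    and cover: "\<And>u v. (u, v) \<in> parcs H \<Longrightarrow> \<exists>s\<in>pverts S. u \<in> B s \<and> v \<in> B s"
    and con: "\<And>v. v \<in> pverts H \<Longrightarrow> Digraph_Component.connected (with_proj S \<restriction> {s \<in> pverts S. v \<in> B s})"
    using SB(1) unfolding tree_decomposition_def by blast+
  have graphS: "pair_graph S" using S unfolding is_tree_def by blast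
  interpret H: pair_graph H by fact
  interpret S: pair_graph S by fact
  have "pverts S \<noteq> {}"
    using S connected_not_empty[of "with_proj S"] unfolding is_tree_def by simp
  then obtain z where "z \<in> pverts S" by blast
  then obtain d p where "layered_tree (parcs S) d p" using tree_layering[OF S] by blast
  then interpret layered_tree "parcs S" d p .
  have con': "conn (parcs S) {s \<in> pverts S. v \<in> B s}" if "v \<in> pverts H" for v
    using connected_imp_conn[OF graphS con[OF that]] .
  define f where "f x = (\<Union>v\<in>M x. {s \<in> pverts S. v \<in> B s})" for x
  show ?thesis
  proof (rule grid_order_le)
    fix c assume c: "c \<in> pverts (grid k)"
    let ?C = "\<Union>x\<in>cross k c. M x"
    have C: "conn (parcs H) ?C" by (rule conn_model_UN[OF M conn_cross[OF c] cross_subset[OF c]])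
    have "?C \<subseteq> pverts H" using cross_subset[OF c] sub by blast
    then have "conn (parcs S) (\<Union>v\<in>?C. {s \<in> pverts S. v \<in> B s})"
      by (intro conn_UN[OF C] con') (use cover in blast)+
    moreover have "(\<Union>v\<in>?C. {s \<in> pverts S. v \<in> B s}) = (\<Union>x\<in>cross k c. f x)"
      unfolding f_def by blast
    ultimately show "conn (parcs S) (\<Union>x\<in>cross k c. f x)" by simp
  next
    fix x assume x: "x \<in> pverts (grid k)"
    obtain v where v: "v \<in> M x" using conn_nonempty[OF minor_modelD(1)[OF M x]] by blast
    then have "v \<in> pverts H" using sub[OF x] by blast
    from conn_nonempty[OF con'[OF this]] show "f x \<noteq> {}"
      using v unfolding f_def by blast
  next
    fix s c assume "s \<in> (\<Union>x\<in>cross k c. f x)"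
    then have s: "s \<in> pverts S" unfolding f_def by blast
    have "{x\<in>pverts (grid k). s \<in> f x} = {x\<in>pverts (grid k). M x \<inter> B s \<noteq> {}}"
      using s unfolding f_def by blast
    then have "card {x\<in>pverts (grid k). s \<in> f x} \<le> card (B s)"
      using card_branch_sets_hit_le[OF M finite_subset[OF bags[OF s] H.pair_finite_verts]] by simp
    also have "\<dots> \<le> Max ((\<lambda>x. card (B x)) ` pverts S)"
      using s S.pair_finite_verts by (intro Max_ge) auto
    \<comment> \<open>Width subtracts 1 with truncation, so adding 1 back gives an upper bound in
      every case.\<close>
    also have "\<dots> \<le> treewidth H + 1"
      unfolding SB(2)[symmetric] decomposition_width_def by simp
    finally show "card {x\<in>pverts (grid k). s \<in> f x} \<le> treewidth H + 1" .
  qed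
qed

text \<open>An edge puts two vertices into one bag. Positivity lets the base case absorb
  \<open>treewidth H + 1\<close> into \<open>5 * treewidth H\<close> and keeps
  \<open>grid_bound\<close> at least 1.\<close>

lemma treewidth_pos:
  assumes H: "pair_graph H" and ne: "parcs H \<noteq> {}"
  shows "1 \<le> treewidth H"
proof -
  obtain S :: "nat pair_pre_digraph" and B
    where SB: "tree_decomposition H S B" "decomposition_width S B = treewidth H"
    by (rule optimal_tree_decomposition[OF H])
  interpret H: pair_graph H by fact
  interpret S: pair_graph S using SB(1) unfolding tree_decomposition_def is_tree_def by blast
  obtain u v where uv: "(u, v) \<in> parcs H" using ne by auto
  then obtain s where s: "s \<in> pverts S" "u \<in> B s" "v \<in> B s"
    using SB(1) unfolding tree_decomposition_def by blast
  have "B s \<subseteq> pverts H" using SB(1) s(1) unfolding tree_decomposition_def by blast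
  then have "finite (B s)" using H.pair_finite_verts finite_subset by blast
  then have "card {u, v} \<le> card (B s)" using s by (intro card_mono) auto
  then have "2 \<le> card (B s)" using H.no_loops'[OF uv] by simp
  also have "\<dots> \<le> Max ((\<lambda>x. card (B x)) ` pverts S)"
    using s S.pair_finite_verts by (intro Max_ge) auto
  finally show ?thesis using SB(2) unfolding decomposition_width_def by simp
qed

lemma lex_product_simps:
  "pverts (lex_product G H) = pverts G \<times> pverts H"
  "(x, y) \<in> parcs (lex_product G H) \<longleftrightarrow> x \<in> pverts G \<times> pverts H \<and> y \<in> pverts G \<times> pverts H \<and>
     ((fst x, fst y) \<in> parcs G \<or> fst x = fst y \<and> (snd x, snd y) \<in> parcs H)"
  by (cases x; cases y; auto simp: lex_product_def)+

lemma conn_fst_lex_product: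
  assumes "conn (parcs (lex_product G H)) C"
  shows "conn (parcs G) (fst ` C)"
  by (rule conn_image[OF assms]) (auto simp: lex_product_simps)

text \<open>The bramble argument with \<open>T\<close> as the tree: the copy of \<open>H\<close>
  over a node plays the role of a bag. The bound is independent of the depth and supplies
  \<open>k <= n\<close> in the induction step.\<close>

lemma lex_grid_order_le_card:
  assumes T: "layered_tree (parcs T) d p" and fin: "finite (pverts H)"
    and M: "minor_model (grid k) (parcs (lex_product T H)) M"
    and sub: "\<And>x. x \<in> pverts (grid k) \<Longrightarrow> M x \<subseteq> pverts (lex_product T H)"
  shows "k \<le> card (pverts H)"
proof -
  interpret layered_tree "parcs T" d p by fact
  show ?thesis
  proof (rule grid_order_le)
    fix c assume c: "c \<in> pverts (grid k)"
    show "conn (parcs T) (\<Union>x\<in>cross k c. fst ` M x)"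
      using conn_fst_lex_product[OF conn_model_UN[OF M conn_cross[OF c] cross_subset[OF c]]]
      by (simp add: image_UN)
  next
    fix x assume "x \<in> pverts (grid k)"
    then show "fst ` M x \<noteq> {}" using conn_nonempty minor_modelD(1)[OF M] by blast
  next
    fix v
    have "v \<in> fst ` M x \<longleftrightarrow> M x \<inter> {v} \<times> pverts H \<noteq> {}" if "x \<in> pverts (grid k)" for x
    proof -
      have "M x \<subseteq> pverts T \<times> pverts H" using sub[OF that] by (simp add: lex_product_simps)
      then show ?thesis by force
    qed
    then have "{x\<in>pverts (grid k). v \<in> fst ` M x} = {x\<in>pverts (grid k). M x \<inter> {v} \<times> pverts H \<noteq> {}}"
      by blast
    also have "card \<dots> \<le> card ({v} \<times> pverts H)"
      by (rule card_branch_sets_hit_le[OF M]) (use fin in simp)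
    finally show "card {x\<in>pverts (grid k). v \<in> fst ` M x} \<le> card (pverts H)"
      by (simp add: card_cartesian_product)
  qed
qed

section \<open>The bounding function and the induction on depth\<close>

definition grid_bound :: "nat \<Rightarrow> nat \<Rightarrow> nat \<Rightarrow> real" where
  "grid_bound n t r = real n powr (1 - 1 / 2 ^ r) * real t powr (1 / 2 ^ r)"

lemma grid_bound_0: "1 \<le> n \<Longrightarrow> 1 \<le> t \<Longrightarrow> grid_bound n t 0 = real t"
  by (simp add: grid_bound_def)

lemma grid_bound_ge_1:
  assumes "1 \<le> n" "1 \<le> t"
  shows "1 \<le> grid_bound n t r"
proof -
  have "(1::real) \<le> 2 ^ r" by simp
  then have "1 * 1 \<le> grid_bound n t r"
    unfolding grid_bound_def using assms by (intro mult_mono ge_one_powr_ge_zero) simp_all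
  then show ?thesis by simp
qed

text \<open>Squaring doubles exponents, and \<open>2 (1 - 1/2^(r+1)) = 1 + (1 - 1/2^r)\<close>
  splits off one factor \<open>n\<close>.\<close>

lemma grid_bound_Suc:
  assumes "1 \<le> n" "1 \<le> t"
  shows "(grid_bound n t (Suc r))\<^sup>2 = real n * grid_bound n t r"
proof -
  have "(real n powr (1 - 1 / 2 ^ Suc r))\<^sup>2 = real n powr (1 + (1 - 1 / 2 ^ r))"
    using assms by (simp add: power2_eq_square flip: powr_add)
  also have "\<dots> = real n * real n powr (1 - 1 / 2 ^ r)"
    unfolding powr_add using assms by simp
  finally have "(real n powr (1 - 1 / 2 ^ Suc r))\<^sup>2 = real n * real n powr (1 - 1 / 2 ^ r)" .
  moreover have "(real t powr (1 / 2 ^ Suc r))\<^sup>2 = real t powr (1 / 2 ^ r)"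
    using assms by (simp add: power2_eq_square flip: powr_add)
  ultimately show ?thesis
    unfolding grid_bound_def power_mult_distrib by simp
qed

text \<open>A connected set of tree nodes of equal depth is a single node, since any node other than
  its top has its parent, one level higher, in the set. The model thus lies in one copy of
  \<open>H\<close>, where the second projection is injective.\<close>

lemma lex_grid_order_in_layer_le:
  assumes T: "layered_tree (parcs T) d p" and H: "pair_graph H"
    and M: "minor_model (grid k) (parcs (lex_product T H)) M" and "1 \<le> k"
    and sub: "\<And>x. x \<in> pverts (grid k) \<Longrightarrow> M x \<subseteq> pverts (lex_product T H)"
    and depth: "\<And>x u. x \<in> pverts (grid k) \<Longrightarrow> u \<in> M x \<Longrightarrow> d (fst u) = l"
  shows "k \<le> treewidth H + 1"
proof (rule grid_order_le_treewidth[OF H])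
  interpret layered_tree "parcs T" d p by fact
  let ?C = "fst ` (\<Union>x\<in>pverts (grid k). M x)"
  have "conn (parcs T) ?C"
    by (rule conn_fst_lex_product[OF conn_model_UN[OF M conn_grid[OF \<open>1 \<le> k\<close>] order_refl]])
  then obtain t where t: "\<And>v. v \<in> ?C \<Longrightarrow> v \<noteq> t \<Longrightarrow> p v \<in> ?C \<and> d v = Suc (d (p v))"
    using conn_top by metis
  have depth': "d v = l" if "v \<in> ?C" for v using that depth by auto
  have C: "v = t" if v: "v \<in> ?C" for v
  proof (rule ccontr)
    assume "v \<noteq> t"
    then have "p v \<in> ?C" "d v = Suc (d (p v))" using t[OF v] by blast+
    then show False using depth'[OF v] depth'[of "p v"] by simp
  qed
  have fst: "fst u = t" if "x \<in> pverts (grid k)" "u \<in> M x" for x u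
    by (rule C) (use that in blast)
  \<comment> \<open>Over the single node \<open>t\<close> the tree contributes no arc, so all arcs
    used by the model come from \<open>H\<close>.\<close>
  have irrefl: "(t, t) \<notin> parcs T" using edge[of t t] by auto
  have arc: "(snd u, snd v) \<in> parcs H"
    if "x \<in> pverts (grid k)" "y \<in> pverts (grid k)" "u \<in> M x" "v \<in> M y" "(u, v) \<in> parcs (lex_product T H)"
    for x y u v
    using that(5) fst[OF that(1,3)] fst[OF that(2,4)] irrefl by (auto simp: lex_product_simps)
  show "minor_model (grid k) (parcs H) (\<lambda>x. snd ` M x)"
    unfolding minor_model_def
  proof (intro conjI ballI allI impI)
    fix x assume x: "x \<in> pverts (grid k)"
    show "conn (parcs H) (snd ` M x)"
      by (rule conn_image[OF minor_modelD(1)[OF M x]]) (use arc[OF x x] in blast)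
  next
    fix x y assume xy: "x \<in> pverts (grid k)" "y \<in> pverts (grid k)" "x \<noteq> y"
    show "snd ` M x \<inter> snd ` M y = {}"
    proof (rule ccontr)
      assume "snd ` M x \<inter> snd ` M y \<noteq> {}"
      then obtain u v where uv: "u \<in> M x" "v \<in> M y" "snd u = snd v" by auto
      then have "u = v" using fst[OF xy(1)] fst[OF xy(2)] by (metis prod_eqI)
      then show False using minor_modelD(2)[OF M xy] uv by blast
    qed
  next
    fix x y assume xy: "(x, y) \<in> parcs (grid k)"
    have V: "x \<in> pverts (grid k)" "y \<in> pverts (grid k)" using xy by (auto simp: grid_def)
    obtain u v where "u \<in> M x" "v \<in> M y" "(u, v) \<in> parcs (lex_product T H)"
      using minor_modelD(3)[OF M xy] by blast
    then show "\<exists>a\<in>snd ` M x. \<exists>b\<in>snd ` M y. (a, b) \<in> parcs H"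
      using arc[OF V] by blast
  qed
  show "snd ` M x \<subseteq> pverts H" if "x \<in> pverts (grid k)" for x
    using sub[OF that] by (auto simp: lex_product_simps)
qed

text \<open>\<open>T\<close> stays fixed, and the induction runs over the width \<open>r\<close> of
  the window \<open>[l, l + r]\<close> of depths that the model occupies. Avoiding the copy of
  \<open>H\<close> at the top node raises the lower end by one, so \<open>l\<close> must be
  arbitrary.\<close>

lemma lex_grid_order_le:
  assumes T: "layered_tree (parcs T) d p" and H: "pair_graph H" "parcs H \<noteq> {}"
    and M: "minor_model (grid k) (parcs (lex_product T H)) M"
    and sub: "\<And>x. x \<in> pverts (grid k) \<Longrightarrow> M x \<subseteq> pverts (lex_product T H)"
    and depth: "\<And>x u. x \<in> pverts (grid k) \<Longrightarrow> u \<in> M x \<Longrightarrow> l \<le> d (fst u) \<and> d (fst u) \<le> l + r"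
  shows "real k \<le> 5 * grid_bound (card (pverts H)) (treewidth H) r"
  using M sub depth
proof (induct r arbitrary: k M l)
  interpret H: pair_graph H by fact
  let ?n = "card (pverts H)" and ?t = "treewidth H"
  obtain v where "v \<in> pverts H" using H(2) H.in_arcsD1 by fastforce
  then have n: "1 \<le> ?n"
    using H.pair_finite_verts by (metis One_nat_def Suc_leI card_gt_0_iff empty_iff)
  have t: "1 \<le> ?t" by (rule treewidth_pos[OF H])
  {
    case 0
    show ?case
    proof (cases "1 \<le> k")
      case True
      have "k \<le> ?t + 1"
        by (rule lex_grid_order_in_layer_le[OF T H(1) "0.prems"(1) True, where l = l])
          (use "0.prems"(2,3) in \<open>fastforce+\<close>)
      then show ?thesis using t by (simp add: grid_bound_0[OF n t])
    qed (use grid_bound_ge_1[OF n t, of 0] in simp)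
  next
    case (Suc r)
    interpret layered_tree "parcs T" d p by fact
    note M = Suc.prems(1) and sub = Suc.prems(2) and depth = Suc.prems(3)
    show ?case
    proof (cases "1 \<le> k")
      case True
      let ?C = "fst ` (\<Union>x\<in>pverts (grid k). M x)"
      have "conn (parcs T) ?C"
        by (rule conn_fst_lex_product[OF conn_model_UN[OF M conn_grid[OF True] order_refl]])
      then obtain c where c: "c \<in> ?C" "\<And>v. v \<in> ?C \<Longrightarrow> \<exists>i. (p ^^ i) v = c \<and> d v = d c + i"
        by (rule conn_top) blast
      have below: "Suc (d c) \<le> d v" if v: "v \<in> ?C" "v \<noteq> c" for v
      proof -
        obtain i where i: "(p ^^ i) v = c" "d v = d c + i" using c(2)[OF v(1)] by blast
        then show ?thesis using v(2) by (cases i) simp_all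
      qed
      \<comment> \<open>The largest grid order the induction hypothesis permits, so a grid minor of
        order \<open>a + 1\<close> one level below is contradictory.\<close>
      define a where "a = nat \<lfloor>5 * grid_bound ?n ?t r\<rfloor>"
      have "5 \<le> 5 * grid_bound ?n ?t r" using grid_bound_ge_1[OF n t, of r] by simp
      then have a: "4 \<le> a" "real a \<le> 5 * grid_bound ?n ?t r" "5 * grid_bound ?n ?t r < real (a + 1)"
        unfolding a_def by linarith+
      define X where "X = {x\<in>pverts (grid k). M x \<inter> {c} \<times> pverts H \<noteq> {}}"
      have finX: "finite X" unfolding X_def by (simp add: pverts_grid)
      have cardX: "card X \<le> ?n"
        using card_branch_sets_hit_le[OF M, of "{c} \<times> pverts H"] H.pair_finite_verts
        unfolding X_def by (simp add: card_cartesian_product)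
      have off: "fst u \<noteq> c" if "x \<in> pverts (grid k)" "x \<notin> X" "u \<in> M x" for x u
      proof
        assume "fst u = c"
        moreover have "u \<in> pverts T \<times> pverts H"
          using sub[OF that(1)] that(3) by (auto simp: lex_product_simps)
        ultimately have "u \<in> M x \<inter> {c} \<times> pverts H" using that(3) by (auto simp: mem_Times_iff)
        then show False using that(1,2) unfolding X_def by blast
      qed
      have "k * k \<le> 5 * ?n * a"
      proof (rule square_le_of_blocks)
        show "k \<le> ?n"
          by (rule lex_grid_order_le_card[OF T H.pair_finite_verts M sub])
        fix q :: nat assume "1 \<le> q"
        define m where "m = k div q"
        have "m - a \<le> card (X \<inter> {i * m<..i * m + m} \<times> {j * m<..j * m + m})"
          if i: "i < q" and j: "j < q" for i j
        proof (rule ccontr)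
          assume "\<not> ?thesis"
          then have few: "card (X \<inter> {i * m<..i * m + m} \<times> {j * m<..j * m + m}) + (a + 1) \<le> m"
            by simp
          \<comment> \<open>Blocks are open at the lower end to match coordinates that start at 1;
            \<open>q\<close> blocks of side \<open>k div q\<close> fit along each side.\<close>
          have inside: "{h * m<..h * m + m} \<subseteq> {1..k}" if "h < q" for h
          proof -
            have "h * m + m \<le> q * m" using mult_le_mono1[of "Suc h" q m] that by simp
            also have "\<dots> \<le> k" unfolding m_def by simp
            finally show ?thesis by auto
          qed
          obtain N where N: "minor_model (grid (a + 1)) (parcs (grid k)) N"
            "\<And>x. x \<in> pverts (grid (a + 1)) \<Longrightarrow> N x \<subseteq> {i * m<..i * m + m} \<times> {j * m<..j * m + m} - X"
            by (rule grid_avoiding[OF inside[OF i] inside[OF j] finX few]) blast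
          have N_sub: "N x \<subseteq> pverts (grid k) - X" if "x \<in> pverts (grid (a + 1))" for x
            using N(2)[OF that] inside[OF i] inside[OF j] unfolding pverts_grid by blast
          \<comment> \<open>Composed with \<open>M\<close>, the subgrid avoids the copy of
            \<open>H\<close> over \<open>c\<close>. Its branch sets then project strictly below
            \<open>c\<close>, that is, into the window \<open>[l + 1, l + 1 + r]\<close>.\<close>
          have "real (a + 1) \<le> 5 * grid_bound ?n ?t r"
          proof (rule Suc.hyps)
            show "minor_model (grid (a + 1)) (parcs (lex_product T H)) (\<lambda>x. \<Union>y\<in>N x. M y)"
              by (rule minor_model_comp[OF N(1) _ M]) (use N_sub in blast)
            show "(\<Union>y\<in>N x. M y) \<subseteq> pverts (lex_product T H)" if "x \<in> pverts (grid (a + 1))" for x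
              using N_sub[OF that] sub by blast
            show "Suc l \<le> d (fst u) \<and> d (fst u) \<le> Suc l + r"
              if x: "x \<in> pverts (grid (a + 1))" and u: "u \<in> (\<Union>y\<in>N x. M y)" for x u
            proof -
              obtain y where y: "y \<in> pverts (grid k)" "y \<notin> X" "u \<in> M y" using N_sub[OF x] u by blast
              have "l \<le> d c" using c(1) depth by auto
              also have "Suc (d c) \<le> d (fst u)"
                by (rule below[OF _ off[OF y]]) (use y in blast)
              finally show ?thesis using depth[OF y(1,3)] by simp
            qed
          qed
          then show False using a(3) by simp
        qed
        then have "q * q * (m - a) \<le> card X" by (rule card_ge_blocks[OF finX])
        then show "q * q * (k div q - a) \<le> ?n" using cardX unfolding m_def by simp
      qed (rule a(1))
      then have "real (k * k) \<le> real (5 * ?n * a)" by (simp only: of_nat_le_iff)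
      then have "(real k)\<^sup>2 \<le> 5 * real ?n * real a" by (simp add: power2_eq_square)
      also have "\<dots> \<le> 5 * real ?n * (5 * grid_bound ?n ?t r)"
        using a(2) by (intro mult_left_mono) simp_all
      \<comment> \<open>The constant reproduces itself: one 5 from the block count and one from the
        induction hypothesis make \<open>5^2\<close>.\<close>
      also have "\<dots> = (5 * grid_bound ?n ?t (Suc r))\<^sup>2"
        by (simp add: power_mult_distrib grid_bound_Suc[OF n t])
      finally show ?thesis
        by (rule power2_le_imp_le) (use grid_bound_ge_1[OF n t, of "Suc r"] in simp)
    qed (use grid_bound_ge_1[OF n t, of "Suc r"] in simp)
  }
qed

theorem theorem13:
  fixes T :: "'a pair_pre_digraph" and H :: "'b pair_pre_digraph" and r n :: nat
  assumes "is_tree T"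
    and "radius T = ereal (real r)"
    and "pair_graph H"
    and "card (pverts H) = n"
    and "parcs H \<noteq> {}"
  shows "real (gm (lex_product T H)) \<le>
    5 * real n powr (1 - 1 / 2 ^ r) * real (treewidth H) powr (1 / 2 ^ r)"
proof -
  have T: "pair_graph T" using assms(1) unfolding is_tree_def by blast
  let ?G = "lex_product T H" and ?k = "gm (lex_product T H)"
  have G: "pair_graph ?G" by (rule pair_graph_lex_product[OF T assms(3)])
  have "?k \<in> {k. is_minor (grid k) ?G}"
    unfolding gm_def by (rule Max_in) (use gm_well_defined[OF G] in auto)
  then obtain M where M: "minor_model (grid ?k) (parcs ?G) M"
    "\<And>x. x \<in> pverts (grid ?k) \<Longrightarrow> M x \<subseteq> pverts ?G"
    using is_minor_imp_minor_model[OF G] by blast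
  obtain z where z: "z \<in> pverts T" "\<forall>v\<in>pverts T. \<exists>i\<le>r. (z, v) \<in> parcs T ^^ i"
    using radius_le_imp_centre[OF T, of r] assms(2) by auto
  obtain d p where dp: "layered_tree (parcs T) d p" "\<And>v i. (z, v) \<in> parcs T ^^ i \<Longrightarrow> d v \<le> i"
    using tree_layering[OF assms(1) z(1)] by blast
  \<comment> \<open>Rooting at a centre places all nodes in the depth window
    \<open>[0, r]\<close>.\<close>
  have "d v \<le> r" if "v \<in> pverts T" for v
    using z(2) that dp(2) order_trans by blast
  then have "real ?k \<le> 5 * grid_bound (card (pverts H)) (treewidth H) r"
    using M(2) by (intro lex_grid_order_le[OF dp(1) assms(3,5) M, where l = 0])
      (fastforce simp: lex_product_simps)+
  then show ?thesis by (simp add: grid_bound_def assms(4))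
qed

end
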